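(* Let $(\mathfrak P,\mathfrak T,\mathfrak e)$ be a state system (as defined in the context) with poset of states $(\mathfrak S,\sqsubseteq)$ and set of pure states $\mathfrak S_{pure}$, and assume that every pure state is a maximal element of $\mathfrak S$. Then every state is a mixture of pure states: $$\forall\sigma\in\mathfrak S,\qquad \sigma=\inf\{\tau\in\mathfrak S_{pure}\mid\sigma\sqsubseteq\tau\}.$$ Moreover, $\mathfrak S_{pure}$ is the unique smallest subset $X\subseteq\mathfrak S$ that is order-generating, i.e. such that $\sigma=\inf\{\tau\in X\mid \sigma\sqsubseteq\tau\}$ for every $\sigma\in\mathfrak S$.
   Context: Let $\mathfrak B=\{\bot,\mathbf Y,\mathbf N\}$ with partial order $u\le v$ iff $u=\bot$ or $u=v$, and involution $\overline{\bot}=\bot$, $\overline{\mathbf Y}=\mathbf N$, $\overline{\mathbf N}=\mathbf Y$. The data are: sets $\mathfrak P$ (preparations) and $\mathfrak T$ (yes/no tests), a map $\mathfrak e:\mathfrak P\times\mathfrak T\to\mathfrak B$, and a map $\mathfrak t\mapsto\overline{\mathfrak t}$ on $\mathfrak T$ with $\mathfrak e(\mathfrak p,\overline{\mathfrak t})=\overline{\mathfrak e(\mathfrak p,\mathfrak t)}$ for all $\mathfrak p,\mathfrak t$. Put $\mathfrak p_1\sim\mathfrak p_2$ iff $\mathfrak e(\mathfrak p_1,\mathfrak t)=\mathfrak e(\mathfrak p_2,\mathfrak t)$ for all $\mathfrak t$; $\mathfrak S=\mathfrak P/\sim$ is the set of states, $\lceil\mathfrak p\rceil$ is the class of $\mathfrak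 p$, $\widetilde{\mathfrak e}_{\mathfrak t}(\lceil\mathfrak p\rceil)=\mathfrak e(\mathfrak p,\mathfrak t)$, and $\sigma_1\sqsubseteq\sigma_2$ iff $\widetilde{\mathfrak e}_{\mathfrak t}(\sigma_1)\le\widetilde{\mathfrak e}_{\mathfrak t}(\sigma_2)$ for all $\mathfrak t\in\mathfrak T$ (a partial order on $\mathfrak S$). $\sqcap,\inf$ and $\sqcup,\bigsqcup$ are infima and (when they exist) suprema in $\mathfrak S$; $\sigma\sqsubset\tau$ means $\sigma\sqsubseteq\tau$, $\sigma\ne\tau$; $\sigma\lessdot\tau$ means that $\tau$ covers $\sigma$. A state system is such data satisfying: (A1) for every nonempty $P\subseteq\mathfrak P$ there is a unique element of $\mathfrak P$, denoted $\inf P$, with $\mathfrak e(\inf P,\mathfrak t)=\bigwedge_{\mathfrak p\in P}\mathfrak e(\mathfrak p,\mathfrak t)$ for all $\mathfrak t$ (so every nonempty subset of $\mathfrak S$ has an infimum); (A2) there is a unique $\mathfrak p_\bot\in\mathfrak P$ with $\mathfrak e(\mathfrak p_\bot,\mathfrak t)=\bot$ for all $\mathfrak t$; (A3) every nonempty chain in $\mathfrak S$ has a supremum in $\mathfrak S$; (A4) for every $\mathfrak t\in\mathfrak T$ and every nonempty chain $\mathfrak C\subseteq\mathfrak S$, if $\widetilde{\mathfrak e}_{\mathfrak t}(\bigsqcup\mathfrak C)=\mathbf Y$ then $\widetilde{\mathfrak e}_{\mathfrak t}(\sigma)=\mathbf Y$ for some $\sigma\in\mathfrak C$; (A5) if $\sigma\sqsubset\sigma'$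 then there is $\sigma''$ with $\sigma\lessdot\sigma''\sqsubseteq\sigma'$; (A6) (a) if $\sigma_1\sqsubseteq\sigma_2\sqsubseteq\sigma_2'$ there is $\sigma_1'$ with $\sigma_1=\sigma_1'\sqcap\sigma_2$ and $\sigma_2'=\sigma_1'\sqcup\sigma_2$; (b) if $\sigma_1'\sqsubseteq\sigma_2'$, $\sigma_2\lessdot\sigma_2'$ and $\sigma_1'\not\sqsubseteq\sigma_2$, then $(\sigma_1'\sqcap\sigma_2)\lessdot\sigma_1'$; (c) if $\sigma_1\sqsubseteq\sigma_1'\sqsubseteq\sigma_2'$, $\sigma_1\lessdot\sigma_2\sqsubseteq\sigma_2'$ and $\sigma_2\not\sqsubseteq\sigma_1'$, then $\sigma_1'\lessdot(\sigma_1'\sqcup\sigma_2)$. A state $\sigma$ is pure ($\sigma\in\mathfrak S_{pure}$) if for every nonempty $S\subseteq\mathfrak S$, $\sigma=\inf S$ implies $\sigma\in S$. *)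

theory Defs
  imports Main "HOL-Algebra.Order"
begin

section \<open>Outcomes of yes/no tests\<close>

datatype outcome = Undet | Yes | No

fun outcome_neg :: "outcome \<Rightarrow> outcome" where
  "outcome_neg Undet = Undet"
| "outcome_neg Yes = No"
| "outcome_neg No = Yes"

definition outcome_poset :: "outcome gorder" where
  "outcome_poset = \<lparr>carrier = UNIV, eq = (=), le = (\<lambda>u v. u = Undet \<or> u = v)\<rparr>"

lemma outcome_poset_simps [simp]:
  "carrier outcome_poset = UNIV"
  "u .=\<^bsub>outcome_poset\<^esub> v \<longleftrightarrow> u = v"
  "u \<sqsubseteq>\<^bsub>outcome_poset\<^esub> v \<longleftrightarrow> u = Undet \<or> u = v"
  by (simp_all add: outcome_poset_def)

lemma partial_order_outcome: "partial_order outcome_poset"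
  by unfold_locales (auto simp: fun_eq_iff)


section \<open>Order-theoretic notions\<close>

text \<open>Infima of subsets are only formed for nonempty subsets: the poset of states need not have a
  greatest element, and if it has one, that element does not count as the infimum of the empty
  set.\<close>

definition is_inf :: "'a gorder \<Rightarrow> 'a \<Rightarrow> 'a set \<Rightarrow> bool" where
  "is_inf L x A \<longleftrightarrow> A \<noteq> {} \<and> A \<subseteq> carrier L \<and> is_glb L x A"

definition covers :: "'a gorder \<Rightarrow> 'a \<Rightarrow> 'a \<Rightarrow> bool" where
  "covers L y x \<longleftrightarrow> x \<in> carrier L \<and> y \<in> carrier L \<and> x \<sqsubset>\<^bsub>L\<^esub> y \<and>
     \<not> (\<exists>z\<in>carrier L. x \<sqsubset>\<^bsub>L\<^esub> z \<and> z \<sqsubset>\<^bsub>L\<^esub> y)"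

definition maximal :: "'a gorder \<Rightarrow> 'a \<Rightarrow> bool" where
  "maximal L x \<longleftrightarrow> x \<in> carrier L \<and> \<not> (\<exists>y\<in>carrier L. x \<sqsubset>\<^bsub>L\<^esub> y)"

definition pure :: "'a gorder \<Rightarrow> 'a set" where
  "pure L = {x \<in> carrier L. \<forall>A. is_inf L x A \<longrightarrow> x \<in> A}"

definition order_generating :: "'a gorder \<Rightarrow> 'a set \<Rightarrow> bool" where
  "order_generating L X \<longleftrightarrow> X \<subseteq> carrier L \<and>
     (\<forall>x\<in>carrier L. is_inf L x {y \<in> X. x \<sqsubseteq>\<^bsub>L\<^esub> y})"

definition smallest_order_generating :: "'a gorder \<Rightarrow> 'a set \<Rightarrow> bool" where
  "smallest_order_generating L X \<longleftrightarrow> order_generating L X \<and>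
     (\<forall>Y. order_generating L Y \<longrightarrow> X \<subseteq> Y)"


section \<open>States of a preparation/test structure\<close>

text \<open>Preparations and tests are carrier sets \<open>P\<close> and \<open>T\<close> rather than whole types, so that
  \<open>T\<close> may be empty.\<close>

definition prep_equiv :: "'p set \<Rightarrow> 't set \<Rightarrow> ('p \<Rightarrow> 't \<Rightarrow> outcome) \<Rightarrow> ('p \<times> 'p) set" where
  "prep_equiv P T e = {(p, q). p \<in> P \<and> q \<in> P \<and> (\<forall>t\<in>T. e p t = e q t)}"

definition states :: "'p set \<Rightarrow> 't set \<Rightarrow> ('p \<Rightarrow> 't \<Rightarrow> outcome) \<Rightarrow> 'p set set" where
  "states P T e = P // prep_equiv P T e"

text \<open>The function \<open>\<lambda>p. e p t\<close> is constant on each state, so its image is a singleton.\<close>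

definition state_eval :: "('p \<Rightarrow> 't \<Rightarrow> outcome) \<Rightarrow> 't \<Rightarrow> 'p set \<Rightarrow> outcome" where
  "state_eval e t \<sigma> = the_elem ((\<lambda>p. e p t) ` \<sigma>)"

definition state_poset :: "'p set \<Rightarrow> 't set \<Rightarrow> ('p \<Rightarrow> 't \<Rightarrow> outcome) \<Rightarrow> 'p set gorder" where
  "state_poset P T e =
     \<lparr>carrier = states P T e, eq = (=),
      le = (\<lambda>\<sigma> \<tau>. \<forall>t\<in>T. state_eval e t \<sigma> \<sqsubseteq>\<^bsub>outcome_poset\<^esub> state_eval e t \<tau>)\<rparr>"

lemma equiv_prep_equiv: "equiv P (prep_equiv P T e)"
  by (auto simp: equiv_def prep_equiv_def refl_on_def sym_def trans_def)

lemma state_eval_class: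
  assumes "p \<in> P" "t \<in> T"
  shows "state_eval e t (prep_equiv P T e `` {p}) = e p t"
proof -
  have "(\<lambda>q. e q t) ` (prep_equiv P T e `` {p}) = {e p t}"
    using assms by (force simp: prep_equiv_def)
  then show ?thesis
    by (simp add: state_eval_def)
qed

lemma state_poset_simps [simp]:
  "carrier (state_poset P T e) = states P T e"
  "\<sigma> .=\<^bsub>state_poset P T e\<^esub> \<tau> \<longleftrightarrow> \<sigma> = \<tau>"
  "\<sigma> \<sqsubseteq>\<^bsub>state_poset P T e\<^esub> \<tau> \<longleftrightarrow>
     (\<forall>t\<in>T. state_eval e t \<sigma> \<sqsubseteq>\<^bsub>outcome_poset\<^esub> state_eval e t \<tau>)"
  by (simp_all add: state_poset_def)

lemma state_eqI:
  assumes "\<sigma> \<in> states P T e" "\<tau> \<in> states P T e"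
    and "\<And>t. t \<in> T \<Longrightarrow> state_eval e t \<sigma> = state_eval e t \<tau>"
  shows "\<sigma> = \<tau>"
proof -
  obtain p q where p: "p \<in> P" "\<sigma> = prep_equiv P T e `` {p}"
    and q: "q \<in> P" "\<tau> = prep_equiv P T e `` {q}"
    using assms(1,2) by (auto simp: states_def elim!: quotientE)
  have "e p t = e q t" if "t \<in> T" for t
    using assms(3)[OF that] that p q by (simp add: state_eval_class)
  then have "(p, q) \<in> prep_equiv P T e"
    using p q by (simp add: prep_equiv_def)
  then show ?thesis
    using p q equiv_class_eq[OF equiv_prep_equiv] by metis
qed

lemma partial_order_state_poset: "partial_order (state_poset P T e)"
proof unfold_locales
  fix \<sigma> \<tau>
  assume "\<sigma> \<sqsubseteq>\<^bsub>state_poset P T e\<^esub> \<tau>" "\<tau> \<sqsubseteq>\<^bsub>state_poset P T e\<^esub> \<sigma>"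
    "\<sigma> \<in> carrier (state_poset P T e)" "\<tau> \<in> carrier (state_poset P T e)"
  then show "\<sigma> .=\<^bsub>state_poset P T e\<^esub> \<tau>"
    by simp (metis state_eqI)
qed (simp_all add: fun_eq_iff, metis+)


section \<open>State systems\<close>

locale prep_test_data =
  fixes P :: "'p set"
    and T :: "'t set"
    and e :: "'p \<Rightarrow> 't \<Rightarrow> outcome"
    and cmpl :: "'t \<Rightarrow> 't"
  assumes cmpl_closed: "t \<in> T \<Longrightarrow> cmpl t \<in> T"
    and eval_cmpl: "p \<in> P \<Longrightarrow> t \<in> T \<Longrightarrow> e p (cmpl t) = outcome_neg (e p t)"

text \<open>Axioms \<open>A6b\<close> and \<open>A6c\<close> speak about the meet, respectively join, of two states; these are
  rendered as the existence of a (necessarily unique) greatest lower, respectively least upper,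
  bound with the stated property.\<close>

locale state_system = prep_test_data P T e cmpl
  for P :: "'p set"
    and T :: "'t set"
    and e :: "'p \<Rightarrow> 't \<Rightarrow> outcome"
    and cmpl :: "'t \<Rightarrow> 't" +
  fixes \<SS> (structure)
  defines "\<SS> \<equiv> state_poset P T e"
  assumes A1: "\<lbrakk>Q \<subseteq> P; Q \<noteq> {}\<rbrakk> \<Longrightarrow>
      \<exists>!p. p \<in> P \<and> (\<forall>t\<in>T. is_inf outcome_poset (e p t) ((\<lambda>q. e q t) ` Q))"
    and A2: "\<exists>!p. p \<in> P \<and> (\<forall>t\<in>T. e p t = Undet)"
    and A3: "\<lbrakk>C \<subseteq> carrier \<SS>; C \<noteq> {}; Complete_Partial_Order.chain (\<sqsubseteq>) C\<rbrakk> \<Longrightarrow>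
      \<exists>\<sigma>. is_lub \<SS> \<sigma> C"
    and A4: "\<lbrakk>t \<in> T; C \<subseteq> carrier \<SS>; C \<noteq> {}; Complete_Partial_Order.chain (\<sqsubseteq>) C;
        is_lub \<SS> \<rho> C; state_eval e t \<rho> = Yes\<rbrakk> \<Longrightarrow>
      \<exists>\<sigma>\<in>C. state_eval e t \<sigma> = Yes"
    and A5: "\<lbrakk>\<sigma> \<in> carrier \<SS>; \<sigma>' \<in> carrier \<SS>; \<sigma> \<sqsubset> \<sigma>'\<rbrakk> \<Longrightarrow>
      \<exists>\<sigma>''\<in>carrier \<SS>. covers \<SS> \<sigma>'' \<sigma> \<and> \<sigma>'' \<sqsubseteq> \<sigma>'"
    and A6a: "\<lbrakk>\<sigma>\<^sub>1 \<in> carrier \<SS>; \<sigma>\<^sub>2 \<in> carrier \<SS>; \<sigma>\<^sub>2' \<in> carrier \<SS>; \<sigma>\<^sub>1 \<sqsubseteq> \<sigma>\<^sub>2; \<sigma>\<^sub>2 \<sqsubseteq> \<sigma>\<^sub>2'\<rbrakk> \<Longrightarrow>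
      \<exists>\<sigma>\<^sub>1'\<in>carrier \<SS>. is_glb \<SS> \<sigma>\<^sub>1 {\<sigma>\<^sub>1', \<sigma>\<^sub>2} \<and> is_lub \<SS> \<sigma>\<^sub>2' {\<sigma>\<^sub>1', \<sigma>\<^sub>2}"
    and A6b: "\<lbrakk>\<sigma>\<^sub>1' \<in> carrier \<SS>; \<sigma>\<^sub>2 \<in> carrier \<SS>; \<sigma>\<^sub>2' \<in> carrier \<SS>;
        \<sigma>\<^sub>1' \<sqsubseteq> \<sigma>\<^sub>2'; covers \<SS> \<sigma>\<^sub>2' \<sigma>\<^sub>2; \<not> \<sigma>\<^sub>1' \<sqsubseteq> \<sigma>\<^sub>2\<rbrakk> \<Longrightarrow>
      \<exists>\<mu>. is_glb \<SS> \<mu> {\<sigma>\<^sub>1', \<sigma>\<^sub>2} \<and> covers \<SS> \<sigma>\<^sub>1' \<mu>"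
    and A6c: "\<lbrakk>\<sigma>\<^sub>1 \<in> carrier \<SS>; \<sigma>\<^sub>1' \<in> carrier \<SS>; \<sigma>\<^sub>2 \<in> carrier \<SS>; \<sigma>\<^sub>2' \<in> carrier \<SS>;
        \<sigma>\<^sub>1 \<sqsubseteq> \<sigma>\<^sub>1'; \<sigma>\<^sub>1' \<sqsubseteq> \<sigma>\<^sub>2'; covers \<SS> \<sigma>\<^sub>2 \<sigma>\<^sub>1; \<sigma>\<^sub>2 \<sqsubseteq> \<sigma>\<^sub>2'; \<not> \<sigma>\<^sub>2 \<sqsubseteq> \<sigma>\<^sub>1'\<rbrakk> \<Longrightarrow>
      \<exists>\<nu>. is_lub \<SS> \<nu> {\<sigma>\<^sub>1', \<sigma>\<^sub>2} \<and> covers \<SS> \<nu> \<sigma>\<^sub>1'"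

end

theory Submission
  imports Defs
begin

text \<open>The argument is that of algebraic lattices. If a state \<open>\<sigma>\<close> does not answer a test \<open>t\<close> with
  \<open>Yes\<close>, then by \<open>A3\<close>, \<open>A4\<close> and Zorn's lemma there is a state \<open>\<tau>\<close> above \<open>\<sigma>\<close> that is maximal among
  those not answering \<open>Yes\<close>. All states strictly above \<open>\<tau>\<close> answer \<open>Yes\<close>, hence so does every infimum of
  them, and \<open>\<tau>\<close> is pure. So any lower bound of the pure states above \<open>\<sigma>\<close> answers \<open>Yes\<close> only where
  \<open>\<sigma>\<close> does; the involution on tests handles \<open>No\<close>.\<close>

text \<open>A pure element is the infimum of the members of \<open>X\<close> above it, and purity
  makes it one of those members.\<close>

lemma pure_subset_order_generating:
  assumes "order_generating L X"
  shows "pure L \<subseteq> X"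
  using assms unfolding order_generating_def pure_def by blast

lemma smallest_order_generating_pure_iff:
  assumes "order_generating L (pure L)"
  shows "smallest_order_generating L X \<longleftrightarrow> X = pure L"
  using assms pure_subset_order_generating unfolding smallest_order_generating_def by blast

context state_system
begin

lemma carrier_states: "carrier \<SS> = states P T e"
  by (simp add: \<SS>_def)

lemma state_le_iff: "\<sigma> \<sqsubseteq> \<tau> \<longleftrightarrow>
    (\<forall>t\<in>T. state_eval e t \<sigma> = Undet \<or> state_eval e t \<sigma> = state_eval e t \<tau>)"
  by (simp add: \<SS>_def)

lemma state_le_refl: "\<sigma> \<sqsubseteq> \<sigma>"
  by (simp add: state_le_iff)

lemma state_le_trans: "\<sigma> \<sqsubseteq> \<tau> \<Longrightarrow> \<tau> \<sqsubseteq> \<rho> \<Longrightarrow> \<sigma> \<sqsubseteq> \<rho>"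
  unfolding state_le_iff by metis

lemma state_le_antisym:
  "\<sigma> \<in> carrier \<SS> \<Longrightarrow> \<tau> \<in> carrier \<SS> \<Longrightarrow> \<sigma> \<sqsubseteq> \<tau> \<Longrightarrow> \<tau> \<sqsubseteq> \<sigma> \<Longrightarrow> \<sigma> = \<tau>"
  unfolding carrier_states state_le_iff by (metis state_eqI)

lemma state_eval_cmpl:
  assumes "\<sigma> \<in> carrier \<SS>" "t \<in> T"
  shows "state_eval e (cmpl t) \<sigma> = outcome_neg (state_eval e t \<sigma>)"
proof -
  obtain p where "p \<in> P" "\<sigma> = prep_equiv P T e `` {p}"
    using assms(1) by (auto simp: carrier_states states_def elim!: quotientE)
  then show ?thesis
    using assms(2) by (simp add: state_eval_class cmpl_closed eval_cmpl)
qed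

text \<open>By \<open>A1\<close> infima of preparations are computed test by test, and they induce
  lower bounds among the states. Since \<open>Yes\<close> is maximal among outcomes, it passes from
  such a lower bound to the greatest one, \<tau>.\<close>

lemma state_eval_inf_Yes:
  assumes inf: "is_inf \<SS> \<tau> A" and "t \<in> T" and Yes: "\<And>\<sigma>. \<sigma> \<in> A \<Longrightarrow> state_eval e t \<sigma> = Yes"
  shows "state_eval e t \<tau> = Yes"
proof -
  have A: "A \<noteq> {}" "A \<subseteq> states P T e" and glb: "is_glb \<SS> \<tau> A"
    using inf by (simp_all add: is_inf_def carrier_states)
  \<comment> \<open>\<open>A1\<close> speaks of preparations, so \<open>A\<close> is replaced by the
    union of its classes; no representatives have to be chosen.\<close>
  define Q where "Q = {q \<in> P. prep_equiv P T e `` {q} \<in> A}"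
  have A_eq: "\<exists>q\<in>Q. \<sigma> = prep_equiv P T e `` {q}" if "\<sigma> \<in> A" for \<sigma>
    using that A(2) by (auto simp: states_def Q_def elim!: quotientE)
  have "Q \<noteq> {}" "Q \<subseteq> P"
    using A(1) A_eq by (auto simp: Q_def)
  then obtain p where p: "p \<in> P"
    and p_inf: "\<And>s. s \<in> T \<Longrightarrow> is_inf outcome_poset (e p s) ((\<lambda>q. e q s) ` Q)"
    using A1 by metis
  let ?\<pi> = "prep_equiv P T e `` {p}"
  have "?\<pi> \<in> carrier \<SS>"
    using p by (simp add: carrier_states states_def quotientI)
  moreover have "?\<pi> \<sqsubseteq> \<sigma>" if "\<sigma> \<in> A" for \<sigma>
  proof -
    obtain q where q: "q \<in> Q" "\<sigma> = prep_equiv P T e `` {q}"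
      using A_eq \<open>\<sigma> \<in> A\<close> by blast
    have "e p s = Undet \<or> e p s = e q s" if "s \<in> T" for s
      using p_inf[OF that] q(1) by (auto simp: is_inf_def greatest_def Lower_def)
    then show ?thesis
      using p q subsetD[OF \<open>Q \<subseteq> P\<close> q(1)] by (simp add: state_le_iff state_eval_class)
  qed
  ultimately have "?\<pi> \<sqsubseteq> \<tau>"
    using glb by (auto simp: greatest_def Lower_def)
  moreover have "state_eval e t ?\<pi> = Yes"
  proof -
    \<comment> \<open>Every preparation in \<open>Q\<close> answers \<open>Yes\<close>, so
      \<open>Yes\<close> lies below the pointwise infimum \<open>e p t\<close>, and only
      \<open>Yes\<close> itself lies above \<open>Yes\<close>.\<close>
    have "Yes \<in> Lower outcome_poset ((\<lambda>q. e q t) ` Q)"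
      using Yes \<open>t \<in> T\<close> by (fastforce simp: Lower_def Q_def state_eval_class)
    then have "e p t = Yes"
      using p_inf[OF \<open>t \<in> T\<close>] by (auto simp: is_inf_def greatest_def)
    then show ?thesis
      using p \<open>t \<in> T\<close> by (simp add: state_eval_class)
  qed
  ultimately show ?thesis
    using \<open>t \<in> T\<close> by (auto simp: state_le_iff)
qed

lemma pure_above_not_Yes:
  assumes "\<sigma> \<in> carrier \<SS>" "t \<in> T" "state_eval e t \<sigma> \<noteq> Yes"
  obtains \<tau> where "\<tau> \<in> pure \<SS>" "\<sigma> \<sqsubseteq> \<tau>" "state_eval e t \<tau> \<noteq> Yes"
proof -
  let ?F = "{\<tau> \<in> carrier \<SS>. \<sigma> \<sqsubseteq> \<tau> \<and> state_eval e t \<tau> \<noteq> Yes}"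
  have \<sigma>: "\<sigma> \<in> ?F"
    using assms by (simp add: state_le_iff)
  have "\<exists>\<tau>\<in>?F. \<forall>\<rho>\<in>?F. \<tau> \<sqsubseteq> \<rho> \<longrightarrow> \<rho> = \<tau>"
  proof (rule predicate_Zorn)
    show "partial_order_on ?F (relation_of (\<sqsubseteq>) ?F)"
      by (rule partial_order_on_relation_ofI)
        (simp add: state_le_refl, blast intro: state_le_trans, rule state_le_antisym, simp_all)
    fix C assume "C \<in> Chains (relation_of (\<sqsubseteq>) ?F)"
    then have C: "C \<subseteq> ?F" and chain: "Complete_Partial_Order.chain (\<sqsubseteq>) C"
      by (auto simp: Chains_def relation_of_def Complete_Partial_Order.chain_def)
    show "\<exists>u\<in>?F. \<forall>\<rho>\<in>C. \<rho> \<sqsubseteq> u"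
    \<comment> \<open>\<open>A3\<close> covers only nonempty chains; the empty one is bounded by
      \<sigma>.\<close>
    proof (cases "C = {}")
      case True
      then show ?thesis using \<sigma> by blast
    next
      case False
      have C_carrier: "C \<subseteq> carrier \<SS>"
        using C by blast
      then obtain u where u: "is_lub \<SS> u C"
        using A3 False chain by blast
      then have "u \<in> carrier \<SS>" and le_u: "\<forall>\<rho>\<in>C. \<rho> \<sqsubseteq> u"
        using C_carrier by (auto simp: least_def Upper_def)
      \<comment> \<open>By \<open>A4\<close>, a \<open>Yes\<close> at the supremum would already
        occur at a member of \<open>C\<close>.\<close>
      moreover have "state_eval e t u \<noteq> Yes"
        using A4[OF \<open>t \<in> T\<close> C_carrier False chain u] C by blast
      moreover have "\<sigma> \<sqsubseteq> u"
        using False C le_u state_le_trans by blast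
      ultimately show ?thesis by blast
    qed
  qed
  then obtain \<tau> where \<tau>: "\<tau> \<in> ?F" and max: "\<And>\<rho>. \<rho> \<in> ?F \<Longrightarrow> \<tau> \<sqsubseteq> \<rho> \<Longrightarrow> \<rho> = \<tau>"
    by blast
  have "\<tau> \<in> A" if inf: "is_inf \<SS> \<tau> A" for A
  proof (rule ccontr)
    assume "\<tau> \<notin> A"
    \<comment> \<open>Each \<rho> in \<open>A\<close> is above \<tau> and differs from it, so by
      maximality it lies outside \<open>?F\<close>; being above \<sigma>, it can only fail
      \<open>?F\<close> by answering \<open>Yes\<close>.\<close>
    have "state_eval e t \<rho> = Yes" if "\<rho> \<in> A" for \<rho>
    proof -
      have "\<rho> \<in> carrier \<SS>" "\<tau> \<sqsubseteq> \<rho>"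
        using inf \<open>\<rho> \<in> A\<close> by (auto simp: is_inf_def greatest_def Lower_def)
      then show ?thesis
        using max[of \<rho>] \<tau> \<open>\<rho> \<in> A\<close> \<open>\<tau> \<notin> A\<close> state_le_trans by blast
    qed
    then show False
      using state_eval_inf_Yes[OF inf \<open>t \<in> T\<close>] \<tau> by blast
  qed
  with \<tau> have "\<tau> \<in> pure \<SS>"
    by (simp add: pure_def)
  with \<tau> that show thesis by blast
qed

text \<open>Needed because \<open>is_inf\<close> demands a nonempty set. A test and its complement
  cannot both be answered \<open>Yes\<close>, so some test always starts the maximality
  argument.\<close>

lemma pure_above_nonempty:
  assumes \<sigma>: "\<sigma> \<in> carrier \<SS>"
  shows "\<exists>\<tau>\<in>pure \<SS>. \<sigma> \<sqsubseteq> \<tau>"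
proof (cases "T = {}")
  \<comment> \<open>Without tests there is a single state, and every nonempty set of states contains
    it.\<close>
  case True
  have "\<rho> = \<sigma>" if "\<rho> \<in> carrier \<SS>" for \<rho>
    by (rule state_le_antisym) (use that \<sigma> True in \<open>simp_all add: state_le_iff\<close>)
  then have "\<sigma> \<in> pure \<SS>"
    using \<sigma> unfolding pure_def is_inf_def by blast
  then show ?thesis
    by (auto simp: state_le_iff)
next
  case False
  then obtain t where "t \<in> T" by blast
  then have "state_eval e t \<sigma> \<noteq> Yes \<or> state_eval e (cmpl t) \<sigma> \<noteq> Yes"
    by (auto simp: state_eval_cmpl[OF \<sigma>])
  then have "\<exists>s\<in>T. state_eval e s \<sigma> \<noteq> Yes"
    using \<open>t \<in> T\<close> cmpl_closed by blast
  then show ?thesis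
    using \<sigma> pure_above_not_Yes by blast
qed

lemma is_inf_pure_above:
  assumes \<sigma>: "\<sigma> \<in> carrier \<SS>"
  shows "is_inf \<SS> \<sigma> {\<tau> \<in> pure \<SS>. \<sigma> \<sqsubseteq> \<tau>}" (is "is_inf \<SS> \<sigma> ?M")
proof -
  have carrier: "?M \<subseteq> carrier \<SS>"
    by (auto simp: pure_def)
  have "\<nu> \<sqsubseteq> \<sigma>" if \<nu>: "\<nu> \<in> carrier \<SS>" and lower: "\<forall>\<tau>\<in>?M. \<nu> \<sqsubseteq> \<tau>" for \<nu>
  proof -
    have Yes: "state_eval e t \<sigma> = Yes" if "t \<in> T" "state_eval e t \<nu> = Yes" for t
    proof (rule ccontr)
      assume "state_eval e t \<sigma> \<noteq> Yes"
      with \<sigma> \<open>t \<in> T\<close> obtain \<tau> where "\<tau> \<in> ?M" "state_eval e t \<tau> \<noteq> Yes"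
        by (blast elim: pure_above_not_Yes)
      with lower that show False
        by (metis state_le_iff outcome.distinct(1))
    qed
    \<comment> \<open>\<open>No\<close> at \<open>t\<close> is \<open>Yes\<close> at
      \<open>cmpl t\<close>, so the previous fact applies to the complement.\<close>
    have "state_eval e t \<sigma> = No" if "t \<in> T" "state_eval e t \<nu> = No" for t
      using Yes[of "cmpl t"] that cmpl_closed state_eval_cmpl \<sigma> \<nu>
      by (cases "state_eval e t \<sigma>") auto
    with Yes show ?thesis
      unfolding state_le_iff by (metis outcome.exhaust)
  qed
  with \<sigma> carrier have "is_glb \<SS> \<sigma> ?M"
    unfolding greatest_def Lower_def by blast
  then show ?thesis
    using carrier pure_above_nonempty[OF \<sigma>] unfolding is_inf_def by blast
qed

lemma order_generating_pure: "order_generating \<SS> (pure \<SS>)"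
  using is_inf_pure_above by (auto simp: order_generating_def pure_def)

end

theorem theorem4:
  fixes P :: "'p set"
    and T :: "'t set"
    and e :: "'p \<Rightarrow> 't \<Rightarrow> outcome"
    and cmpl :: "'t \<Rightarrow> 't"
  assumes "state_system P T e cmpl"
    and "\<forall>\<sigma> \<in> pure (state_poset P T e). maximal (state_poset P T e) \<sigma>"
  shows "(\<forall>\<sigma> \<in> states P T e.
            is_inf (state_poset P T e) \<sigma>
              {\<tau> \<in> pure (state_poset P T e). \<sigma> \<sqsubseteq>\<^bsub>state_poset P T e\<^esub> \<tau>})
       \<and> (\<forall>X. smallest_order_generating (state_poset P T e) X
              \<longleftrightarrow> X = pure (state_poset P T e))"
  using state_system.is_inf_pure_above[OF assms(1)]
    smallest_order_generating_pure_iff[OF state_system.order_generating_pure[OF assms(1)]]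
  \<comment> \<open>Unfolding turns the carrier in the locale facts into
    \<open>states P T e\<close>, as in the goal.\<close>
  by (simp only: state_poset_simps) blast

end
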